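(* Let $n$ range over even integers, and let $d=d(n)=n/2-\eta$, where $\eta=\eta(n)$ satisfies $\eta=\omega(1)$ and $\eta=o(n)$. Then the sharp $d$-threshold for containing a perfect matching is $8\eta/n^2$. That is, for every fixed $\epsilon>0$: (0) there exists a sequence of $n$-vertex graphs $\{H_n\}$ ($n$ even) with $\delta(H_n)\geq d$ such that, if $p\leq(1-\epsilon)8\eta/n^2$, then $\lim_{n\to\infty}\mathbb{P}[H_n\cup G(n,p)\text{ contains a perfect matching}]=0$; and (1) for every sequence of $n$-vertex graphs $\{H_n\}$ ($n$ even) with $\delta(H_n)\geq d$, if $p\geq(1+\epsilon)8\eta/n^2$, then $\lim_{n\to\infty}\mathbb{P}[H_n\cup G(n,p)\text{ contains a perfect matching}]=1$.
   Context: All graphs are simple. A perfect matching is a set of $n/2$ pairwise disjoint edges. $G(n,p)$ is the binomial random graph on the same $n$-vertex set as $H_n$, obtained by including each of the $\binom{n}{2}$ possible edges independently with probability $p$; $H_n\cup G(n,p)$ is the union of the edge sets. $\delta(\cdot)$ denotes minimum degree. Asymptotic notation is as $n\to\infty$. *)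

theory Defs
  imports "HOL-Probability.Probability" "HOL-Library.Ramsey" "HOL-Library.Landau_Symbols"
begin

text \<open>A simple graph on vertex set \<open>V\<close> is represented by its edge set, a set of
  two-element subsets of \<open>V\<close>.\<close>

definition simple_graph :: "'a set \<Rightarrow> 'a set set \<Rightarrow> bool" where
  "simple_graph V E \<longleftrightarrow> E \<subseteq> nsets V 2"

definition degree :: "'a set set \<Rightarrow> 'a \<Rightarrow> nat" where
  "degree E v = card {e \<in> E. v \<in> e}"

text \<open>Meaningful only for finite nonempty \<open>V\<close>.\<close>

definition min_degree :: "'a set \<Rightarrow> 'a set set \<Rightarrow> nat" where
  "min_degree V E = Min (degree E ` V)"

definition perfect_matching :: "'a set \<Rightarrow> 'a set set \<Rightarrow> 'a set set \<Rightarrow> bool" where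
  "perfect_matching V E M \<longleftrightarrow> M \<subseteq> E \<and> disjoint M \<and> 2 * card M = card V"

definition has_perfect_matching :: "'a set \<Rightarrow> 'a set set \<Rightarrow> bool" where
  "has_perfect_matching V E \<longleftrightarrow> (\<exists>M. perfect_matching V E M)"

definition binomial_random_graph :: "'a set \<Rightarrow> real \<Rightarrow> 'a set set pmf" where
  "binomial_random_graph V p =
     map_pmf (\<lambda>f. {e \<in> nsets V 2. f e}) (Pi_pmf (nsets V 2) False (\<lambda>_. bernoulli_pmf p))"

definition prob_perfect_matching :: "nat \<Rightarrow> nat set set \<Rightarrow> real \<Rightarrow> real" where
  "prob_perfect_matching n H p =
     measure_pmf.prob (binomial_random_graph {..<n} p)
       {G. has_perfect_matching {..<n} (H \<union> G)}"

text \<open>The filter for \<open>n \<rightarrow> \<infinity>\<close> along the even integers.\<close>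

definition even_at_top :: "nat filter" where
  "even_at_top = inf at_top (principal {n. even n})"

end

theory Submission
  imports Defs
begin

text \<open>
  Lower bound: take all pairs not inside a set \<open>A\<close> of \<open>n/2 + \<lfloor>\<eta>\<rfloor>\<close> vertices. A perfect matching uses
  at least \<open>\<lfloor>\<eta>\<rfloor>\<close> random edges inside \<open>A\<close>, whose expected number is about \<open>(1 - \<epsilon>) \<eta>\<close>.

  Upper bound: let a graph with minimum degree \<open>k\<close> have a maximum matching missing two vertices
  \<open>a\<close>, \<open>b\<close>. Rotating at \<open>a\<close> uncovers any of \<open>k\<close> vertices \<open>u\<close> instead of \<open>a\<close>, and then rotating at
  \<open>b\<close> uncovers any of \<open>k\<close> vertices \<open>v\<close> instead of \<open>b\<close>; adding the pair \<open>{u, v}\<close> enlarges the matching.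
  So at least \<open>k\<^sup>2/2 \<approx> n\<^sup>2/8\<close> pairs are augmenting, whatever has been added already, while \<open>H\<close> alone
  has a matching of size \<open>k\<close> and needs at most \<open>\<eta>\<close> augmentations. The expectation of \<open>x\<close> to the
  power of the number of missing edges then decays like \<open>exp (- p (1 - 1/x) k\<^sup>2/2)\<close>, and \<open>x = 1 + \<epsilon>/2\<close>
  makes it tend to zero.
\<close>

section \<open>Matchings and the matching number\<close>

definition matching :: "'a set set \<Rightarrow> 'a set set \<Rightarrow> bool" where
  "matching F M \<longleftrightarrow> M \<subseteq> F \<and> disjoint M"

text \<open>The maximum ranges over a nonempty set, since the empty set is a matching; it is
  meaningful for finite \<open>F\<close>.\<close>

definition matching_number :: "'a set set \<Rightarrow> nat" where
  "matching_number F = Max (card ` {M. matching F M})"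

definition maximum_matching :: "'a set set \<Rightarrow> 'a set set \<Rightarrow> bool" where
  "maximum_matching F M \<longleftrightarrow> matching F M \<and> card M = matching_number F"

lemma finite_matchings: "finite F \<Longrightarrow> finite {M. matching F M}"
  by (rule finite_subset[of _ "Pow F"]) (auto simp: matching_def)

lemma card_matching_le:
  assumes "finite F" "matching F M"
  shows "card M \<le> matching_number F"
  unfolding matching_number_def using assms finite_matchings by (intro Max_ge) auto

lemma maximum_matching_exists:
  assumes "finite F"
  obtains M where "maximum_matching F M"
proof -
  have "matching F {}" by (simp add: matching_def)
  then have "card ` {M. matching F M} \<noteq> {}" by blast
  then have "matching_number F \<in> card ` {M. matching F M}"
    unfolding matching_number_def using assms finite_matchings by (intro Max_in) auto
  then show ?thesis using that by (auto simp: maximum_matching_def)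
qed

lemma matching_mono: "matching F M \<Longrightarrow> F \<subseteq> F' \<Longrightarrow> matching F' M"
  by (auto simp: matching_def)

lemma matching_insert:
  assumes "matching F M" "e \<in> F" "e \<inter> \<Union>M = {}"
  shows "matching F (insert e M)"
  using assms unfolding matching_def pairwise_insert by (auto simp: disjnt_def)

lemma matching_number_mono:
  assumes "finite F'" "F \<subseteq> F'"
  shows "matching_number F \<le> matching_number F'"
proof -
  obtain M where "maximum_matching F M"
    using maximum_matching_exists assms finite_subset by metis
  then show ?thesis
    using card_matching_le[OF assms(1)] matching_mono[OF _ assms(2)]
    unfolding maximum_matching_def by metis
qed

lemma card_Union_matching:
  assumes "finite V" "F \<subseteq> nsets V 2" "matching F M"
  shows "card (\<Union>M) = 2 * card M"
proof -
  have M: "finite e \<and> card e = 2" if "e \<in> M" for e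
    using that assms by (auto simp: matching_def nsets_def)
  have "card (\<Union>M) = sum card M"
    using assms(3) M by (intro card_Union_disjoint) (auto simp: matching_def)
  then show ?thesis using M by simp
qed

lemma Union_matching_subset: "F \<subseteq> nsets V 2 \<Longrightarrow> matching F M \<Longrightarrow> \<Union>M \<subseteq> V"
  by (auto simp: matching_def nsets_def)

lemma finite_matching: "finite V \<Longrightarrow> F \<subseteq> nsets V 2 \<Longrightarrow> matching F M \<Longrightarrow> finite M"
  by (meson finite_imp_finite_nsets finite_subset matching_def)

text \<open>Replaces the event by a threshold on a number that never decreases when edges are added,
  so that progress can be measured. No matching exceeds half of \<open>V\<close>, and evenness makes
  \<open>card V div 2\<close> exact.\<close>

lemma has_perfect_matching_iff:
  assumes "finite V" "F \<subseteq> nsets V 2" "even (card V)"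
  shows "has_perfect_matching V F \<longleftrightarrow> card V div 2 \<le> matching_number F"
proof -
  have fin: "finite F" using assms finite_imp_finite_nsets finite_subset by metis
  obtain M where M: "maximum_matching F M" using maximum_matching_exists[OF fin] .
  have "2 * card M \<le> card V"
    using card_Union_matching[OF assms(1,2)] Union_matching_subset[OF assms(2)] M
      card_mono[OF assms(1)] unfolding maximum_matching_def by metis
  then have *: "2 * matching_number F \<le> card V" using M by (simp add: maximum_matching_def)
  show ?thesis
  proof
    assume "has_perfect_matching V F"
    then obtain M' where "matching F M'" "2 * card M' = card V"
      by (auto simp: has_perfect_matching_def perfect_matching_def matching_def)
    then show "card V div 2 \<le> matching_number F" using card_matching_le[OF fin] by fastforce
  next
    assume "card V div 2 \<le> matching_number F"
    then have "2 * card M = card V" using * M assms(3) by (auto simp: maximum_matching_def)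
    then show "has_perfect_matching V F" using M
      by (auto simp: has_perfect_matching_def perfect_matching_def matching_def maximum_matching_def)
  qed
qed

section \<open>Rotations of maximum matchings and augmenting pairs\<close>

lemma card_neighbours:
  assumes "F \<subseteq> nsets V 2"
  shows "card {x. {w, x} \<in> F} = degree F w"
proof -
  have "bij_betw (\<lambda>x. {w, x}) {x. {w, x} \<in> F} {e \<in> F. w \<in> e}"
  proof (rule bij_betwI')
    show "\<exists>x\<in>{x. {w, x} \<in> F}. e = {w, x}" if "e \<in> {e \<in> F. w \<in> e}" for e
    proof -
      have "card e = 2" using that assms by (auto simp: nsets_def)
      then show ?thesis using that by (auto simp: card_2_iff doubleton_eq_iff insert_commute)
    qed
  qed (auto simp: doubleton_eq_iff)
  then show ?thesis unfolding degree_def by (rule bij_betw_same_card)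
qed

text \<open>An edge from \<open>w\<close> to an uncovered vertex could be added to \<open>M\<close>,
  contradicting maximality.\<close>

lemma neighbours_subset_Union_maximum:
  assumes "finite V" "F \<subseteq> nsets V 2" "maximum_matching F M" "w \<notin> \<Union>M"
  shows "{x. {w, x} \<in> F} \<subseteq> \<Union>M"
proof (rule ccontr)
  assume "\<not> ?thesis"
  then obtain x where x: "{w, x} \<in> F" "x \<notin> \<Union>M" by auto
  have fin: "finite F" using assms finite_imp_finite_nsets finite_subset by metis
  have M: "matching F M" "finite M"
    using assms(3) finite_matching[OF assms(1,2)] by (auto simp: maximum_matching_def)
  have "matching F (insert {w, x} M)"
    using matching_insert[OF M(1) x(1)] x(2) assms(4) by auto
  then have "card (insert {w, x} M) \<le> card M"
    using card_matching_le[OF fin] assms(3) by (auto simp: maximum_matching_def)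
  moreover have "{w, x} \<notin> M" using x by auto
  ultimately show False using M(2) by simp
qed

text \<open>Replacing the matching edge at a neighbour \<open>x\<close> of \<open>w\<close> by \<open>{w, x}\<close> uncovers the former
  partner of \<open>x\<close>; distinct neighbours have distinct partners.\<close>

lemma maximum_matching_swap:
  assumes "finite V" "F \<subseteq> nsets V 2" "maximum_matching F M" "w \<notin> \<Union>M"
  obtains R where "R \<subseteq> \<Union>M" "card R = degree F w"
    "\<And>y. y \<in> R \<Longrightarrow> \<exists>M'. maximum_matching F M' \<and> \<Union>M' = insert w (\<Union>M) - {y}"
proof -
  let ?N = "{x. {w, x} \<in> F}"
  have M: "M \<subseteq> F" "disjoint M" "finite M"
    using assms finite_matching[OF assms(1,2)] by (auto simp: maximum_matching_def matching_def)
  have M_eq: "a = b" if "a \<in> M" "b \<in> M" "z \<in> a" "z \<in> b" for a b z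
    using M(2) that by (auto simp: pairwise_def disjnt_def)
  have "\<exists>y. {x, y} \<in> M \<and> y \<noteq> x" if x: "x \<in> ?N" for x
  proof -
    obtain e where e: "e \<in> M" "x \<in> e"
      using neighbours_subset_Union_maximum[OF assms] x by auto
    then have "card e = 2" using M assms by (auto simp: nsets_def)
    then show ?thesis using e by (auto simp: card_2_iff insert_commute)
  qed
  \<comment> \<open>\<open>f x\<close> is the partner of \<open>x\<close> under \<open>M\<close>; it
    exists because every neighbour of \<open>w\<close> is covered.\<close>
  then obtain f where f: "\<And>x. x \<in> ?N \<Longrightarrow> {x, f x} \<in> M" "\<And>x. x \<in> ?N \<Longrightarrow> f x \<noteq> x" by metis
  show ?thesis
  proof (rule that[of "f ` ?N"])
    show "f ` ?N \<subseteq> \<Union>M" using f by blast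
    have "inj_on f ?N"
    proof (rule inj_onI)
      fix x x' assume *: "x \<in> ?N" "x' \<in> ?N" "f x = f x'"
      have "{x, f x} = {x', f x'}" using M_eq[OF f(1)[OF *(1)] f(1)[OF *(2)], of "f x"] * by auto
      then show "x = x'" using f(2)[OF *(1)] f(2)[OF *(2)] * by auto
    qed
    then show "card (f ` ?N) = degree F w"
      using card_image card_neighbours[OF assms(2)] by metis
    fix y assume "y \<in> f ` ?N"
    then obtain x where x: "{w, x} \<in> F" "y = f x" by auto
    have xy: "{x, y} \<in> M" "y \<noteq> x" using f x by auto
    let ?M0 = "M - {{x, y}}"
    let ?M' = "insert {w, x} ?M0"
    have U: "\<Union>?M0 = \<Union>M - {x, y}" using M_eq[OF _ xy(1)] xy by auto
    have ne: "w \<noteq> x" "w \<noteq> y" using xy assms(4) by auto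
    have "matching F ?M'"
    proof (rule matching_insert)
      show "matching F ?M0"
        using M by (auto simp: matching_def pairwise_def)
      show "{w, x} \<inter> \<Union>?M0 = {}" unfolding U using assms(4) by auto
    qed (rule x)
    moreover have "card ?M' = card M"
    proof -
      have "{w, x} \<notin> M" using assms(4) by auto
      then show ?thesis using M(3) card_Suc_Diff1[OF M(3) xy(1)] by (simp del: card_Diff_insert)
    qed
    moreover have "\<Union>?M' = insert w (\<Union>M) - {y}"
      using U ne xy by auto
    ultimately show "\<exists>M'. maximum_matching F M' \<and> \<Union>M' = insert w (\<Union>M) - {y}"
      using assms(3) unfolding maximum_matching_def by metis
  qed
qed

text \<open>The number of uncovered vertices is \<open>card V - 2 * card M\<close>, which is even
  and positive.\<close>

lemma two_uncovered_vertices: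
  assumes "finite V" "F \<subseteq> nsets V 2" "even (card V)"
    and "matching_number F < card V div 2" "maximum_matching F M"
  obtains a b where "a \<in> V" "b \<in> V" "a \<noteq> b" "a \<notin> \<Union>M" "b \<notin> \<Union>M"
proof -
  have M: "matching F M" "card M = matching_number F"
    using assms(5) by (auto simp: maximum_matching_def)
  have "card (V - \<Union>M) = card V - 2 * card M"
    using card_Union_matching[OF assms(1,2) M(1)] Union_matching_subset[OF assms(2) M(1)]
      finite_subset[OF _ assms(1)] by (simp add: card_Diff_subset)
  then have "2 \<le> card (V - \<Union>M)" using assms(3,4) M(2) by auto
  then obtain T where "T \<subseteq> V - \<Union>M" "card T = 2" by (meson obtain_subset_with_card_n)
  then show ?thesis using that by (auto simp: card_2_iff)
qed

text \<open>Let a maximum matching \<open>M\<close> miss \<open>a\<close> and \<open>b\<close>. The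
  vertices that a rotation at \<open>a\<close> can uncover and the neighbours of \<open>b\<close>
  are disjoint: a common vertex would give a maximum matching missing both ends of an edge at
  \<open>b\<close>. Both sets have at least \<open>k\<close> elements and are covered by
  \<open>M\<close>, so \<open>2 * k\<close> is at most \<open>2 * matching_number F\<close>.\<close>

lemma matching_number_ge_min_degree:
  assumes "finite V" "F \<subseteq> nsets V 2" "even (card V)"
    and deg: "\<And>v. v \<in> V \<Longrightarrow> k \<le> degree F v"
  shows "min k (card V div 2) \<le> matching_number F"
proof (cases "matching_number F < card V div 2")
  case True
  have fin: "finite F" using assms finite_imp_finite_nsets finite_subset by metis
  obtain M where M: "maximum_matching F M" using maximum_matching_exists[OF fin] .
  obtain a b where ab: "a \<in> V" "b \<in> V" "a \<noteq> b" "a \<notin> \<Union>M" "b \<notin> \<Union>M"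
    using two_uncovered_vertices[OF assms(1-3) True M] .
  obtain R where R: "R \<subseteq> \<Union>M" "card R = degree F a"
    "\<And>y. y \<in> R \<Longrightarrow> \<exists>M'. maximum_matching F M' \<and> \<Union>M' = insert a (\<Union>M) - {y}"
    using maximum_matching_swap[OF assms(1,2) M ab(4)] by metis
  let ?N = "{x. {b, x} \<in> F}"
  have N: "?N \<subseteq> \<Union>M" by (rule neighbours_subset_Union_maximum[OF assms(1,2) M ab(5)])
  have "y \<notin> ?N" if y: "y \<in> R" for y
  proof -
    obtain M' where M': "maximum_matching F M'" "\<Union>M' = insert a (\<Union>M) - {y}"
      using R(3)[OF y] by auto
    then have "b \<notin> \<Union>M'" using ab by auto
    then show ?thesis using neighbours_subset_Union_maximum[OF assms(1,2) M'(1)] M'(2) by blast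
  qed
  then have disj: "R \<inter> ?N = {}" by auto
  have fU: "finite (\<Union>M)" and cU: "card (\<Union>M) = 2 * matching_number F"
    using M card_Union_matching[OF assms(1,2)] Union_matching_subset[OF assms(2)] finite_subset[OF _ assms(1)]
    by (auto simp: maximum_matching_def)
  have "2 * k \<le> card R + card ?N"
    using R(2) card_neighbours[OF assms(2)] deg[OF ab(1)] deg[OF ab(2)] by simp
  also have "\<dots> = card (R \<union> ?N)"
    using disj R(1) N fU finite_subset by (metis card_Un_disjoint)
  also have "\<dots> \<le> card (\<Union>M)" using R(1) N fU by (intro card_mono) auto
  finally show ?thesis using cU by simp
qed simp

lemma matching_number_insert_gt:
  assumes "finite V" "F \<subseteq> nsets V 2" "maximum_matching F M"
    and "u \<in> V" "v \<in> V" "u \<noteq> v" "u \<notin> \<Union>M" "v \<notin> \<Union>M"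
  shows "matching_number F < matching_number (insert {u, v} F)"
proof -
  have fin: "finite (insert {u, v} F)" using assms finite_imp_finite_nsets finite_subset
    by (metis finite_insert)
  have M: "matching F M" "finite M"
    using assms(3) finite_matching[OF assms(1,2)] by (auto simp: maximum_matching_def)
  have "matching (insert {u, v} F) (insert {u, v} M)"
    using M(1) assms(7,8) by (intro matching_insert matching_mono[OF M(1)]) auto
  then have "card (insert {u, v} M) \<le> matching_number (insert {u, v} F)"
    by (rule card_matching_le[OF fin])
  moreover have "{u, v} \<notin> M" using assms by auto
  ultimately show ?thesis using M(2) assms(3) by (simp add: maximum_matching_def)
qed

text \<open>Two successive rotations turn the missed vertices \<open>a\<close>, \<open>b\<close>
  into \<open>u\<close>, \<open>v\<close>, with at least \<open>k\<close> choices of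
  \<open>u\<close> and then at least \<open>k\<close> of \<open>v\<close>. A pair arises from at
  most two ordered choices, hence the factor 2. Only the minimum degree of \<open>F\<close> enters,
  so the bound survives the addition of random edges.\<close>

lemma card_augmenting_pairs:
  assumes "finite V" "F \<subseteq> nsets V 2" "even (card V)"
    and "matching_number F < card V div 2"
    and deg: "\<And>v. v \<in> V \<Longrightarrow> k \<le> degree F v"
  shows "k\<^sup>2 \<le> 2 * card {e \<in> nsets V 2. matching_number F < matching_number (insert e F)}"
    (is "_ \<le> 2 * card ?P")
proof -
  have fin: "finite F" "finite (nsets V 2)" using assms finite_imp_finite_nsets finite_subset by metis+
  obtain M where M: "maximum_matching F M" using maximum_matching_exists[OF fin(1)] .
  obtain a b where ab: "a \<in> V" "b \<in> V" "a \<noteq> b" "a \<notin> \<Union>M" "b \<notin> \<Union>M"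
    using two_uncovered_vertices[OF assms(1-4) M] .
  obtain R where R: "R \<subseteq> \<Union>M" "card R = degree F a"
    "\<And>y. y \<in> R \<Longrightarrow> \<exists>M'. maximum_matching F M' \<and> \<Union>M' = insert a (\<Union>M) - {y}"
    using maximum_matching_swap[OF assms(1,2) M ab(4)] by metis
  have UV: "\<Union>M' \<subseteq> V" if "maximum_matching F M'" for M'
    using that Union_matching_subset[OF assms(2)] by (auto simp: maximum_matching_def)
  have "\<exists>S. S \<subseteq> V \<and> k \<le> card S \<and> (\<forall>v\<in>S. u \<noteq> v \<and> {u, v} \<in> ?P)" if u: "u \<in> R" for u
  proof -
    obtain M' where M': "maximum_matching F M'" "\<Union>M' = insert a (\<Union>M) - {u}"
      using R(3)[OF u] by auto
    \<comment> \<open>The first rotation covers \<open>a\<close> and uncovers \<open>u\<close>, so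
      \<open>b\<close> stays uncovered and a second rotation can start there.\<close>
    then have b: "b \<notin> \<Union>M'" using ab by auto
    obtain S where S: "S \<subseteq> \<Union>M'" "card S = degree F b"
      "\<And>y. y \<in> S \<Longrightarrow> \<exists>M''. maximum_matching F M'' \<and> \<Union>M'' = insert b (\<Union>M') - {y}"
      using maximum_matching_swap[OF assms(1,2) M'(1) b] by metis
    have uV: "u \<in> V" using u R(1) UV[OF M] by auto
    have "u \<noteq> v \<and> {u, v} \<in> ?P" if v: "v \<in> S" for v
    proof -
      obtain M'' where M'': "maximum_matching F M''" "\<Union>M'' = insert b (\<Union>M') - {v}"
        using S(3)[OF v] by auto
      have vV: "v \<in> V" using v S(1) UV[OF M'(1)] by auto
      have uv: "u \<noteq> v" using v S(1) M'(2) by auto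
      have ub: "u \<noteq> b" using u R(1) ab by auto
      \<comment> \<open>\<open>M''\<close> misses \<open>u\<close> too, because \<open>M'\<close>
        misses it and \<open>u\<close> differs from \<open>b\<close>; hence both ends of
        \<open>{u, v}\<close> are uncovered.\<close>
      have "matching_number F < matching_number (insert {u, v} F)"
        using M' M'' uv ub by (intro matching_number_insert_gt[OF assms(1,2) M''(1) uV vV uv]) auto
      then show ?thesis using uv uV vV by (auto simp: nsets_def)
    qed
    then show ?thesis using S UV[OF M'(1)] deg[OF ab(2)] by (intro exI[of _ S]) auto
  qed
  then have "\<exists>S. \<forall>u\<in>R. S u \<subseteq> V \<and> k \<le> card (S u) \<and> (\<forall>v\<in>S u. u \<noteq> v \<and> {u, v} \<in> ?P)"
    by (intro bchoice) blast
  then obtain S where S: "\<And>u. u \<in> R \<Longrightarrow> S u \<subseteq> V" "\<And>u. u \<in> R \<Longrightarrow> k \<le> card (S u)"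
    "\<And>u v. u \<in> R \<Longrightarrow> v \<in> S u \<Longrightarrow> u \<noteq> v \<and> {u, v} \<in> ?P" by blast
  have fR: "finite R" using R(1) UV[OF M] assms(1) by (meson finite_subset)
  have fS: "finite (S u)" if "u \<in> R" for u using S(1)[OF that] assms(1) by (rule finite_subset)
  let ?Q = "Sigma R S"
  have fP: "finite ?P" using fin by simp
  have "k\<^sup>2 \<le> card R * k" using R(2) deg[OF ab(1)] by (simp add: power2_eq_square)
  also have "\<dots> \<le> (\<Sum>u\<in>R. card (S u))" using S(2) sum_bounded_below[of R k "\<lambda>u. card (S u)"] by simp
  also have "\<dots> = card ?Q" using fR fS by (simp add: card_SigmaI)
  \<comment> \<open>Ordered pairs are grouped by their underlying edge; each group has at most two
    members.\<close>
  also have "\<dots> \<le> card (\<Union>e\<in>?P. {(u, v). u \<noteq> v \<and> {u, v} = e})"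
  proof (rule card_mono)
    show "finite (\<Union>e\<in>?P. {(u, v). u \<noteq> v \<and> {u, v} = e})"
      by (rule finite_subset[of _ "V \<times> V"]) (use assms(1) in \<open>auto simp: nsets_def\<close>)
    show "?Q \<subseteq> (\<Union>e\<in>?P. {(u, v). u \<noteq> v \<and> {u, v} = e})" using S(3) by fastforce
  qed
  also have "\<dots> \<le> (\<Sum>e\<in>?P. card {(u, v). u \<noteq> v \<and> {u, v} = e})"
    by (rule card_UN_le[OF fP])
  also have "\<dots> \<le> (\<Sum>e\<in>?P. 2)"
  proof (rule sum_mono)
    fix e assume "e \<in> ?P"
    then have "card e = 2" by (auto simp: nsets_def)
    then obtain x y where "e = {x, y}" by (auto simp: card_2_iff)
    then have "{(u, v). u \<noteq> v \<and> {u, v} = e} \<subseteq> {(x, y), (y, x)}" by (auto simp: doubleton_eq_iff)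
    then have "card {(u, v). u \<noteq> v \<and> {u, v} = e} \<le> card {(x, y), (y, x)}" by (intro card_mono) auto
    also have "\<dots> \<le> 2" using card_length[of "[(x, y), (y, x)]"] by simp
    finally show "card {(u, v). u \<noteq> v \<and> {u, v} = e} \<le> 2" .
  qed
  finally show ?thesis by simp
qed

section \<open>The binomial random graph as a finite weighted sum\<close>

text \<open>On the support of \<open>Pi_pmf\<close> every indicator is \<open>False\<close> outside
  the possible edges, so \<open>F\<close> has at most one preimage there. The product over edges
  then splits into those in \<open>F\<close> and the others.\<close>

lemma pmf_binomial_random_graph:
  assumes V: "finite V" and p: "0 \<le> p" "p \<le> 1" and F: "F \<subseteq> nsets V 2"
  shows "pmf (binomial_random_graph V p) F
    = p ^ card F * (1 - p) ^ (card (nsets V 2) - card F)"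
proof -
  let ?E = "nsets V 2"
  let ?P = "Pi_pmf ?E False (\<lambda>_. bernoulli_pmf p)"
  let ?h = "\<lambda>f. {e \<in> ?E. f e}"
  have fin: "finite ?E" using V by (rule finite_imp_finite_nsets)
  have out: "\<forall>e. e \<notin> ?E \<longrightarrow> f e = False" if "f \<in> set_pmf ?P" for f
    using that set_Pi_pmf_subset[OF fin] by fastforce
  have "pmf (binomial_random_graph V p) F = measure_pmf.prob ?P (?h -` {F})"
    unfolding binomial_random_graph_def by (rule pmf_map)
  also have "\<dots> = measure_pmf.prob ?P {\<lambda>e. e \<in> F}"
  proof (rule measure_pmf.finite_measure_eq_AE)
    show "AE f in measure_pmf ?P. (f \<in> ?h -` {F}) = (f \<in> {\<lambda>e. e \<in> F})"
    proof (rule AE_pmfI)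
      fix f assume "f \<in> set_pmf ?P"
      then have o: "\<forall>e. e \<notin> ?E \<longrightarrow> f e = False" by (rule out)
      show "(f \<in> ?h -` {F}) = (f \<in> {\<lambda>e. e \<in> F})"
        using o F by (auto simp: fun_eq_iff)
    qed
  qed auto
  also have "\<dots> = (\<Prod>e\<in>?E. pmf (bernoulli_pmf p) (e \<in> F))"
    using F by (subst measure_pmf_single, intro pmf_Pi'[OF fin]) auto
  also have "\<dots> = (\<Prod>e\<in>F. p) * (\<Prod>e\<in>?E - F. 1 - p)"
  proof -
    have "(\<Prod>e\<in>?E. pmf (bernoulli_pmf p) (e \<in> F))
      = (\<Prod>e\<in>?E - F. pmf (bernoulli_pmf p) (e \<in> F)) * (\<Prod>e\<in>F. pmf (bernoulli_pmf p) (e \<in> F))"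
      by (rule prod.subset_diff[OF F fin])
    also have "(\<Prod>e\<in>?E - F. pmf (bernoulli_pmf p) (e \<in> F)) = (\<Prod>e\<in>?E - F. 1 - p)"
      using p by (intro prod.cong) auto
    also have "(\<Prod>e\<in>F. pmf (bernoulli_pmf p) (e \<in> F)) = (\<Prod>e\<in>F. p)"
      using p by (intro prod.cong) auto
    finally show ?thesis by (simp only: mult.commute)
  qed
  also have "\<dots> = p ^ card F * (1 - p) ^ (card ?E - card F)"
    using F fin by (simp add: card_Diff_subset finite_subset)
  finally show ?thesis .
qed

lemma set_pmf_binomial_random_graph: "set_pmf (binomial_random_graph V p) \<subseteq> Pow (nsets V 2)"
  by (auto simp: binomial_random_graph_def)

text \<open>Markov's inequality: \<open>g\<close> dominates the indicator of \<open>X\<close>, and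
  the right-hand side is the expectation of \<open>g\<close>, spelled out as a finite sum for
  combinatorial manipulation.\<close>

lemma prob_binomial_random_graph_le:
  assumes V: "finite V" and p: "0 \<le> p" "p \<le> 1"
    and g0: "\<And>F. F \<subseteq> nsets V 2 \<Longrightarrow> 0 \<le> g F"
    and g1: "\<And>F. F \<subseteq> nsets V 2 \<Longrightarrow> F \<in> X \<Longrightarrow> 1 \<le> g F"
  shows "measure_pmf.prob (binomial_random_graph V p) X
    \<le> (\<Sum>F\<in>Pow (nsets V 2). p ^ card F * (1 - p) ^ (card (nsets V 2) - card F) * g F)"
proof -
  let ?E = "nsets V 2" and ?Q = "binomial_random_graph V p"
  let ?w = "\<lambda>F. p ^ card F * (1 - p) ^ (card ?E - card F)"
  have fin: "finite (Pow ?E)" using V by (simp add: finite_imp_finite_nsets)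
  have "measure_pmf.prob ?Q X = measure_pmf.prob ?Q (Pow ?E \<inter> X)"
    using set_pmf_binomial_random_graph[of V p]
    by (intro measure_pmf.finite_measure_eq_AE AE_pmfI) auto
  also have "\<dots> = (\<Sum>F\<in>Pow ?E \<inter> X. pmf ?Q F)"
    using fin by (intro measure_measure_pmf_finite) auto
  also have "\<dots> = (\<Sum>F\<in>Pow ?E \<inter> X. ?w F)"
    using pmf_binomial_random_graph[OF V p] by (intro sum.cong) auto
  also have "\<dots> \<le> (\<Sum>F\<in>Pow ?E \<inter> X. ?w F * g F)"
  proof (rule sum_mono)
    fix F assume "F \<in> Pow ?E \<inter> X"
    then have "1 \<le> g F" using g1 by auto
    moreover have "0 \<le> ?w F" using p by simp
    ultimately show "?w F \<le> ?w F * g F" using mult_left_mono by fastforce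
  qed
  also have "\<dots> \<le> (\<Sum>F\<in>Pow ?E. ?w F * g F)"
    using p g0 fin by (intro sum_mono2) auto
  finally show ?thesis .
qed

section \<open>Exponential decay of a potential over random subsets\<close>

text \<open>Double counting the pairs of a set of size \<open>j + 1\<close> and one of its elements.\<close>

lemma sum_subsets_decay:
  fixes g :: "'a set \<Rightarrow> real" and c :: real
  assumes E: "finite E" "E \<noteq> {}" and c: "0 \<le> c" "c \<le> card E"
    and g0: "\<And>F. F \<subseteq> E \<Longrightarrow> 0 \<le> g F"
    and step: "\<And>F. F \<subseteq> E \<Longrightarrow> (\<Sum>e\<in>E. g (insert e F)) \<le> (card E - c) * g F"
  shows "(\<Sum>F | F \<in> Pow E \<and> card F = j. g F) \<le> real (card E choose j) * (1 - c / card E) ^ j * g {}"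
proof (induction j)
  case 0
  have "{F. F \<in> Pow E \<and> card F = 0} = {{}}" using E finite_subset by fastforce
  then show ?case by simp
next
  case (Suc j)
  let ?S = "\<lambda>j. {F. F \<in> Pow E \<and> card F = j}"
  let ?N = "card E"
  let ?r = "1 - c / ?N"
  have N: "0 < ?N" using E by (simp add: card_gt_0_iff)
  have r: "0 \<le> ?r" using c N by simp
  have finS: "finite (?S j)" for j using E(1) by simp
  have finF: "finite F" if "F \<subseteq> E" for F using that E(1) by (rule finite_subset)
  show ?case
  proof (cases "j < ?N")
    case False
    have "card F \<noteq> Suc j" if "F \<subseteq> E" for F using card_mono[OF E(1) that] False by simp
    then have empty: "?S (Suc j) = {}" by auto
    show ?thesis unfolding empty using r g0[of "{}"] by simp
  next
    case True
    have "real (Suc j) * (\<Sum>F\<in>?S (Suc j). g F) = (\<Sum>F\<in>?S (Suc j). \<Sum>e\<in>F. g F)"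
      by (simp add: sum_distrib_left)
    also have "\<dots> = (\<Sum>(F, e)\<in>Sigma (?S (Suc j)) (\<lambda>F. F). g F)"
      by (rule sum.Sigma) (use finS finF in blast)+
    \<comment> \<open>Removing \<open>e\<close> matches the pairs with \<open>e\<close> in the set
      to the pairs with \<open>e\<close> outside a set that is smaller by one.\<close>
    also have "\<dots> = (\<Sum>(F, e)\<in>Sigma (?S j) (\<lambda>F. E - F). g (insert e F))"
      by (rule sum.reindex_bij_witness[of _ "\<lambda>(F, e). (insert e F, e)" "\<lambda>(F, e). (F - {e}, e)"])
        (auto simp: insert_absorb card_insert_if card_Diff_singleton finF)
    also have "\<dots> = (\<Sum>F\<in>?S j. \<Sum>e\<in>E - F. g (insert e F))"
      by (rule sum.Sigma[symmetric]) (use finS E(1) in blast)+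
    also have "\<dots> \<le> (\<Sum>F\<in>?S j. real (?N - j) * ?r * g F)"
    proof (rule sum_mono)
      fix F assume F: "F \<in> ?S j"
      then have FE: "F \<subseteq> E" "card F = j" by auto
      have "(\<Sum>e\<in>E. g (insert e F)) = (\<Sum>e\<in>E - F. g (insert e F)) + (\<Sum>e\<in>F. g (insert e F))"
        by (rule sum.subset_diff[OF FE(1) E(1)])
      \<comment> \<open>Elements of \<open>F\<close> leave the set unchanged and account for
        \<open>j * g F\<close> of the sum bounded by \<open>step\<close>.\<close>
      also have "(\<Sum>e\<in>F. g (insert e F)) = (\<Sum>e\<in>F. g F)"
        by (intro sum.cong) (auto simp: insert_absorb)
      finally have "(\<Sum>e\<in>E - F. g (insert e F)) \<le> (real ?N - real j - c) * g F"
        using step[OF FE(1)] FE(2) by (simp add: algebra_simps)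
      also have "\<dots> \<le> (real (?N - j) * ?r) * g F"
      proof (rule mult_right_mono[OF _ g0[OF FE(1)]])
        have Nj: "real (?N - j) = real ?N - real j" using True by simp
        \<comment> \<open>Weakening \<open>c\<close> to \<open>c * (?N - j) / ?N\<close> makes the
          factor a product of \<open>?N - j\<close> and \<open>?r\<close>; the first part matches
          the recursion of the binomial coefficients.\<close>
        have "c * ((real ?N - real j) / ?N) \<le> c * 1" using c N by (intro mult_left_mono) auto
        also have "c * ((real ?N - real j) / ?N) = (real ?N - real j) * (c / ?N)" by simp
        finally show "real ?N - real j - c \<le> real (?N - j) * ?r"
          unfolding Nj right_diff_distrib by simp
      qed
      finally show "(\<Sum>e\<in>E - F. g (insert e F)) \<le> real (?N - j) * ?r * g F" .
    qed
    also have "\<dots> = real (?N - j) * ?r * (\<Sum>F\<in>?S j. g F)" by (simp only: sum_distrib_left)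
    also have "\<dots> \<le> real (?N - j) * ?r * (real (?N choose j) * ?r ^ j * g {})"
      using Suc.IH r by (intro mult_left_mono) auto
    also have "\<dots> = real (Suc j) * (real (?N choose Suc j) * ?r ^ Suc j * g {})"
    proof -
      have "Suc j * (?N choose Suc j) = (?N - j) * (?N choose j)"
        by (simp only: binomial_absorb_comp binomial_absorption)
      then have "real (Suc j) * real (?N choose Suc j) = real (?N - j) * real (?N choose j)"
        by (metis of_nat_mult)
      then show ?thesis by (simp del: of_nat_Suc of_nat_diff add: ac_simps)
    qed
    finally show ?thesis by (simp del: of_nat_Suc)
  qed
qed

text \<open>By \<open>step\<close>, inserting a uniform element of \<open>E\<close> shrinks
  \<open>g\<close> on average by the factor \<open>1 - c / card E\<close>. Grouping the subsets by
  size, the binomial theorem yields \<open>(1 - p * c / card E) ^ card E\<close>, which is at most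
  the exponential.\<close>

lemma expectation_subset_decay:
  fixes g :: "'a set \<Rightarrow> real" and c :: real
  assumes E: "finite E" "E \<noteq> {}" and c: "0 \<le> c" "c \<le> card E" and p: "0 \<le> p" "p \<le> 1"
    and g0: "\<And>F. F \<subseteq> E \<Longrightarrow> 0 \<le> g F"
    and step: "\<And>F. F \<subseteq> E \<Longrightarrow> (\<Sum>e\<in>E. g (insert e F)) \<le> (card E - c) * g F"
  shows "(\<Sum>F\<in>Pow E. p ^ card F * (1 - p) ^ (card E - card F) * g F) \<le> exp (- (p * c)) * g {}"
proof -
  let ?N = "card E"
  let ?r = "1 - c / ?N"
  let ?S = "\<lambda>j. {F. F \<in> Pow E \<and> card F = j}"
  have N: "0 < ?N" using E by (simp add: card_gt_0_iff)
  have "(\<Sum>F\<in>Pow E. p ^ card F * (1 - p) ^ (?N - card F) * g F)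
    = (\<Sum>j\<le>?N. \<Sum>F\<in>?S j. p ^ card F * (1 - p) ^ (?N - card F) * g F)"
    using E(1) by (intro sum.group[symmetric]) (auto intro: card_mono)
  also have "\<dots> = (\<Sum>j\<le>?N. p ^ j * (1 - p) ^ (?N - j) * (\<Sum>F\<in>?S j. g F))"
    by (simp add: sum_distrib_left)
  also have "\<dots> \<le> (\<Sum>j\<le>?N. p ^ j * (1 - p) ^ (?N - j) * (real (?N choose j) * ?r ^ j * g {}))"
    using p by (intro sum_mono mult_left_mono sum_subsets_decay[OF E c g0 step]) auto
  also have "\<dots> = (\<Sum>j\<le>?N. real (?N choose j) * (p * ?r) ^ j * (1 - p) ^ (?N - j)) * g {}"
    unfolding sum_distrib_right by (intro sum.cong) (auto simp: power_mult_distrib)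
  also have "(\<Sum>j\<le>?N. real (?N choose j) * (p * ?r) ^ j * (1 - p) ^ (?N - j)) = (1 - p * c / ?N) ^ ?N"
    unfolding binomial_ring[symmetric] by (simp add: algebra_simps)
  also have "\<dots> * g {} \<le> exp (- (p * c)) * g {}"
  proof (rule mult_right_mono)
    have "p * c \<le> 1 * real ?N" using p c by (intro mult_mono) auto
    then show "(1 - p * c / ?N) ^ ?N \<le> exp (- (p * c))"
      using N exp_ge_one_minus_x_over_n_power_n[of "p * c" ?N] by simp
  qed (simp add: g0)
  finally show ?thesis .
qed

lemma card_nsets_2: "finite V \<Longrightarrow> real (card (nsets V 2)) = real (card V) * (real (card V) - 1) / 2"
  by (cases "card V") (auto simp: card_nsets choose_two real_of_nat_div algebra_simps)

section \<open>Failure probability under a minimum degree condition\<close>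

text \<open>The potential is \<open>x\<close> to the number of matching edges still missing. At
  least \<open>k^2 / 2\<close> pairs divide it by at least \<open>x\<close>, each saving a share
  \<open>1 - 1 / x\<close>; this gives the decay constant \<open>c\<close>. Initially at most
  \<open>n div 2 - k\<close> edges are missing.\<close>

lemma prob_no_perfect_matching_le:
  assumes n: "even n" "0 < n" and H: "H \<subseteq> nsets {..<n} 2"
    and deg: "\<And>v. v < n \<Longrightarrow> k \<le> degree H v"
    and p: "0 \<le> p" "p \<le> 1" and x: "1 \<le> x"
  shows "1 - prob_perfect_matching n H p
    \<le> exp (- (p * ((real k)\<^sup>2 / 2 * (1 - 1 / x)))) * x ^ (n div 2 - k)"
proof -
  let ?V = "{..<n}"
  let ?E = "nsets ?V 2"
  define c where "c = (real k)\<^sup>2 / 2 * (1 - 1 / x)"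
  define D where "D F = n div 2 - matching_number (H \<union> F)" for F
  \<comment> \<open>The value at deficit zero is 0 and not \<open>x ^ 0\<close>: a potential stuck
    at 1 once a perfect matching is present could not satisfy \<open>step\<close> with positive
    \<open>c\<close>.\<close>
  define g where "g F = (if D F = 0 then 0 else x ^ D F)" for F
  have fE: "finite ?E" by (simp add: finite_imp_finite_nsets)
  have HF: "H \<union> F \<subseteq> ?E" "finite (H \<union> F)" if "F \<subseteq> ?E" for F
    using that H finite_subset[OF _ fE] by auto
  have degF: "k \<le> degree (H \<union> F) v" if F: "F \<subseteq> ?E" and v: "v \<in> ?V" for F v
  proof -
    have "degree H v \<le> degree (H \<union> F) v"
      unfolding degree_def using HF[OF F] by (intro card_mono) auto
    then show ?thesis using deg v by fastforce
  qed
  have perf: "has_perfect_matching ?V (H \<union> F) \<longleftrightarrow> D F = 0" if F: "F \<subseteq> ?E" for F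
    using has_perfect_matching_iff[OF _ HF(1)[OF F]] n by (auto simp: D_def)
  have th: "0 \<le> 1 - 1 / x" "1 - 1 / x \<le> 1" using x by auto
  have cardE: "real (card ?E) = real n * (real n - 1) / 2" using card_nsets_2[of ?V] by simp
  have n2: "2 \<le> n" using n by auto
  have "0 \<in> ?V" "1 \<in> ?V" using n2 by auto
  then have Ene: "?E \<noteq> {}" by (auto simp: nsets_def intro!: exI[of _ "{0, 1}"])
  \<comment> \<open>A vertex has at most \<open>n - 1\<close> neighbours; this keeps
    \<open>c\<close> at most \<open>card ?E\<close>.\<close>
  have kn: "real k \<le> real n - 1"
  proof -
    have "{x. {0, x} \<in> H} \<subseteq> {1..<n}"
    proof
      fix x assume "x \<in> {x. {0, x} \<in> H}"
      then have "{0, x} \<in> nsets ?V 2" using H by auto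
      then show "x \<in> {1..<n}" by (cases "x = 0") (auto simp: nsets_def)
    qed
    from card_mono[OF _ this] have "degree H 0 \<le> n - 1" by (simp add: card_neighbours[OF H])
    then show ?thesis using deg[of 0] n by linarith
  qed
  have c: "0 \<le> c" "c \<le> real (card ?E)"
  proof -
    show "0 \<le> c" using th by (simp add: c_def)
    have "(real k)\<^sup>2 \<le> real n * (real n - 1)"
      unfolding power2_eq_square using kn by (intro mult_mono) auto
    then have "c \<le> real n * (real n - 1) / 2 * 1"
      unfolding c_def using th n2 by (intro mult_mono) auto
    then show "c \<le> real (card ?E)" using cardE by simp
  qed
  have g0: "0 \<le> g F" for F using x by (simp add: g_def)
  have step: "(\<Sum>e\<in>?E. g (insert e F)) \<le> (card ?E - c) * g F" if F: "F \<subseteq> ?E" for F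
  proof -
    have mono: "g (insert e F) \<le> g F" if "e \<in> ?E" for e
    proof -
      have "matching_number (H \<union> F) \<le> matching_number (H \<union> insert e F)"
        using HF(2)[of "insert e F"] F that by (intro matching_number_mono) auto
      then have "D (insert e F) \<le> D F" by (simp add: D_def)
      then show ?thesis using x by (auto simp: g_def intro: power_increasing)
    qed
    show ?thesis
    proof (cases "D F = 0")
      case True
      then have "g F = 0" by (simp add: g_def)
      then have "(\<Sum>e\<in>?E. g (insert e F)) \<le> 0" using mono by (intro sum_nonpos) fastforce
      then show ?thesis using \<open>g F = 0\<close> by simp
    next
      case False
      let ?P = "{e \<in> ?E. matching_number (H \<union> F) < matching_number (insert e (H \<union> F))}"
      have P: "g (insert e F) \<le> 1 / x * g F" if e: "e \<in> ?P" for e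
      proof -
        \<comment> \<open>An augmenting pair lowers the deficit by at least one; if the deficit
          becomes zero, \<open>g\<close> even drops to 0.\<close>
        have "D (insert e F) \<le> D F - 1" "D F \<noteq> 0" using e False by (auto simp: D_def)
        then have "g (insert e F) \<le> x ^ (D F - 1)"
          using x by (auto simp: g_def intro: power_increasing)
        also have "\<dots> = 1 / x * g F" using x False by (cases "D F") (auto simp: g_def)
        finally show ?thesis .
      qed
      have "k\<^sup>2 \<le> 2 * card ?P"
        using False n degF[OF F] by (intro card_augmenting_pairs[OF _ HF(1)[OF F]]) (auto simp: D_def)
      then have "real (k\<^sup>2) \<le> real (2 * card ?P)" by (rule of_nat_mono)
      then have kP: "(real k)\<^sup>2 / 2 \<le> real (card ?P)"
        unfolding of_nat_power of_nat_mult of_nat_numeral by linarith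
      \<comment> \<open>Every summand is at most \<open>g F\<close>, and those of pairs in
        \<open>?P\<close> lose at least the share \<open>1 - 1 / x\<close> of it.\<close>
      have "(\<Sum>e\<in>?E. g (insert e F)) \<le> (\<Sum>e\<in>?E. g F - (if e \<in> ?P then (1 - 1 / x) * g F else 0))"
        using mono P by (intro sum_mono) (auto simp: algebra_simps)
      also have "\<dots> = card ?E * g F - card ?P * ((1 - 1 / x) * g F)"
      proof -
        have P: "?E \<inter> ?P = ?P" by auto
        show ?thesis
          unfolding sum_subtractf sum.inter_restrict[OF fE, symmetric] P by (simp only: sum_constant)
      qed
      also have "\<dots> \<le> card ?E * g F - (real k)\<^sup>2 / 2 * ((1 - 1 / x) * g F)"
        using kP th g0[of F] by (intro diff_left_mono mult_right_mono) auto
      also have "\<dots> = (card ?E - c) * g F" by (simp add: c_def algebra_simps)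
      finally show ?thesis .
    qed
  qed
  let ?Q = "binomial_random_graph ?V p"
  have "1 - prob_perfect_matching n H p = measure_pmf.prob ?Q (- {G. has_perfect_matching ?V (H \<union> G)})"
    unfolding prob_perfect_matching_def
    using measure_pmf.prob_compl[of "{G. has_perfect_matching ?V (H \<union> G)}" ?Q]
    by (simp add: Compl_eq_Diff_UNIV)
  also have "\<dots> \<le> (\<Sum>F\<in>Pow ?E. p ^ card F * (1 - p) ^ (card ?E - card F) * g F)"
    using p x g0 perf by (intro prob_binomial_random_graph_le) (auto simp: g_def)
  also have "\<dots> \<le> exp (- (p * c)) * g {}"
    by (rule expectation_subset_decay[OF fE Ene c p g0 step])
  also have "\<dots> \<le> exp (- (p * c)) * x ^ (n div 2 - k)"
  proof (rule mult_left_mono)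
    \<comment> \<open>If \<open>k\<close> exceeds \<open>n div 2\<close>, the minimum is
      \<open>n div 2\<close> and the truncated difference \<open>n div 2 - k\<close> is 0, so the
      bound on \<open>D {}\<close> still holds.\<close>
    have "min k (n div 2) \<le> matching_number H"
      using matching_number_ge_min_degree[of ?V H k] H deg n by auto
    then have "D {} \<le> n div 2 - k" by (auto simp: D_def)
    then show "g {} \<le> x ^ (n div 2 - k)" using x by (auto simp: g_def intro: power_increasing)
  qed simp
  finally show ?thesis by (simp add: c_def)
qed

section \<open>The extremal graph below the threshold\<close>

text \<open>For \<open>a\<close> at most \<open>n\<close>, an independent set of \<open>a\<close>
  vertices joined completely to a clique on the remaining ones.\<close>

definition touching_edges :: "nat \<Rightarrow> nat \<Rightarrow> nat set set" where
  "touching_edges n a = {e \<in> nsets {..<n} 2. \<not> e \<subseteq> {..<a}}"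

text \<open>Vertices below \<open>a\<close> are adjacent to the \<open>n - a\<close> vertices from
  \<open>a\<close> on; the others have degree \<open>n - 1\<close>, which suffices because
  \<open>a\<close> is positive.\<close>

lemma min_degree_touching_edges:
  assumes "0 < a" "a \<le> n"
  shows "n - a \<le> min_degree {..<n} (touching_edges n a)"
proof -
  let ?H = "touching_edges n a"
  have H: "?H \<subseteq> nsets {..<n} 2" by (auto simp: touching_edges_def)
  have "n - a \<le> degree ?H v" if v: "v < n" for v
  proof -
    let ?N = "{x. {v, x} \<in> ?H}"
    have fin: "finite ?N"
      by (rule finite_subset[of _ "{..<n}"]) (auto simp: touching_edges_def nsets_def)
    have "\<exists>S. S \<subseteq> ?N \<and> n - a \<le> card S"
    proof (cases "v < a")
      case True
      have "{a..<n} \<subseteq> ?N" using True v by (auto simp: touching_edges_def nsets_def)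
      then show ?thesis by (intro exI[of _ "{a..<n}"]) auto
    next
      case False
      have "{..<n} - {v} \<subseteq> ?N" using False v by (auto simp: touching_edges_def nsets_def)
      then show ?thesis using v assms by (intro exI[of _ "{..<n} - {v}"]) auto
    qed
    then have "n - a \<le> card ?N" using card_mono[OF fin] le_trans by blast
    then show ?thesis by (simp add: card_neighbours[OF H])
  qed
  then show ?thesis unfolding min_degree_def using assms by (subst Min_ge_iff) (auto simp: lessThan_empty_iff)
qed

text \<open>The \<open>n div 2\<close> matching edges cover all \<open>n div 2 + k\<close> vertices
  of \<open>{..<a}\<close>. An edge covers at most one of them unless it lies inside, when it covers
  two. So at least \<open>k\<close> edges lie inside, and these can only come from
  \<open>G\<close>.\<close>

lemma perfect_matching_needs_inner_edges:
  assumes "has_perfect_matching {..<n} (touching_edges n a \<union> G)" "G \<subseteq> nsets {..<n} 2"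
    and a: "a = n div 2 + k" "a \<le> n"
  shows "k \<le> card (G \<inter> nsets {..<a} 2)"
proof -
  let ?F = "touching_edges n a \<union> G"
  let ?A = "{..<a}"
  obtain M where M: "matching ?F M" "2 * card M = n"
    using assms(1) by (auto simp: has_perfect_matching_def perfect_matching_def matching_def)
  have F: "?F \<subseteq> nsets {..<n} 2" using assms(2) by (auto simp: touching_edges_def)
  have fM: "finite M" using finite_matching[OF _ F M(1)] by simp
  have e2: "card e = 2" "finite e" if "e \<in> M" for e
    using that M(1) F by (auto simp: matching_def nsets_def)
  have "card (\<Union>M) = n" using card_Union_matching[OF _ F M(1)] M(2) by simp
  then have U: "\<Union>M = {..<n}"
    using Union_matching_subset[OF F M(1)] by (intro card_subset_eq) auto
  let ?I = "{e \<in> M. e \<subseteq> ?A}"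
  have "a = card (\<Union>e\<in>M. e \<inter> ?A)"
  proof -
    have "(\<Union>e\<in>M. e \<inter> ?A) = ?A" using U a(2) by auto
    then show ?thesis by simp
  qed
  also have "\<dots> \<le> (\<Sum>e\<in>M. card (e \<inter> ?A))" by (rule card_UN_le[OF fM])
  also have "\<dots> \<le> (\<Sum>e\<in>M. 1 + (if e \<in> ?I then 1 else 0))"
  proof (rule sum_mono)
    fix e assume e: "e \<in> M"
    show "card (e \<inter> ?A) \<le> 1 + (if e \<in> ?I then 1 else 0)"
    proof (cases "e \<subseteq> ?A")
      case True
      then show ?thesis using e e2[OF e] card_mono[of e "e \<inter> ?A"] by auto
    next
      case False
      then have "card (e \<inter> ?A) < card e" using e2[OF e] by (intro psubset_card_mono) auto
      then show ?thesis using e2[OF e] by simp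
    qed
  qed
  also have "\<dots> = card M + card ?I"
  proof -
    have "M \<inter> ?I = ?I" by auto
    then show ?thesis using fM by (simp only: sum.distrib sum.If_cases) simp
  qed
  finally have "k \<le> card ?I" using M(2) a(1) by simp
  also have "\<dots> \<le> card (G \<inter> nsets ?A 2)"
  proof (rule card_mono)
    show "finite (G \<inter> nsets ?A 2)" by (simp add: finite_imp_finite_nsets)
    show "?I \<subseteq> G \<inter> nsets ?A 2"
      using M(1) e2 by (auto simp: matching_def touching_edges_def nsets_def)
  qed
  finally show ?thesis .
qed

text \<open>Exponential Markov inequality for the number of random edges inside
  \<open>{..<a}\<close>, of which a perfect matching needs at least \<open>k\<close>. By
  independence the expectation of \<open>x\<close> to that number factorises over the edges.\<close>

lemma prob_touching_edges_le:
  assumes a: "a = n div 2 + k" "a \<le> n" and p: "0 \<le> p" "p \<le> 1" and x: "1 \<le> x"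
  shows "prob_perfect_matching n (touching_edges n a) p
    \<le> exp (p * (real a)\<^sup>2 / 2 * (x - 1)) / x ^ k"
proof -
  let ?V = "{..<n}"
  let ?E = "nsets ?V 2" and ?T = "nsets {..<a} 2"
  \<comment> \<open>Writing the power of \<open>x\<close> as a product of edge weights lets
    \<open>prod_add\<close> evaluate the sum over all subsets.\<close>
  let ?y = "\<lambda>e. if e \<in> ?T then x else 1"
  let ?g = "\<lambda>F. (\<Prod>e\<in>F. ?y e) / x ^ k"
  have fE: "finite ?E" "finite ?T" by (simp_all add: finite_imp_finite_nsets)
  have TE: "?E \<inter> ?T = ?T" using a by (auto simp: nsets_def)
  have prod: "(\<Prod>e\<in>F. ?y e) = x ^ card (F \<inter> ?T)" if "F \<subseteq> ?E" for F
    using finite_subset[OF that fE(1)] by (simp add: prod.If_cases)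
  have "prob_perfect_matching n (touching_edges n a) p
    \<le> (\<Sum>F\<in>Pow ?E. p ^ card F * (1 - p) ^ (card ?E - card F) * ?g F)"
    unfolding prob_perfect_matching_def
  proof (rule prob_binomial_random_graph_le)
    fix F assume F: "F \<subseteq> ?E"
    show "0 \<le> ?g F" unfolding prod[OF F] using x by simp
    assume "F \<in> {G. has_perfect_matching ?V (touching_edges n a \<union> G)}"
    then have "k \<le> card (F \<inter> ?T)"
      using perfect_matching_needs_inner_edges[OF _ F a] by simp
    then have "x ^ k \<le> x ^ card (F \<inter> ?T)" using x by (rule power_increasing)
    then show "1 \<le> ?g F" unfolding prod[OF F] using x by simp
  qed (use p in auto)
  also have "\<dots> = (\<Sum>F\<in>Pow ?E. (\<Prod>e\<in>F. p * ?y e) * (\<Prod>e\<in>?E - F. 1 - p)) / x ^ k"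
    unfolding sum_divide_distrib
    using finite_subset[OF _ fE(1)]
    by (intro sum.cong) (auto simp: prod.distrib card_Diff_subset simp del: card_nsets)
  also have "\<dots> = (\<Prod>e\<in>?E. p * ?y e + (1 - p)) / x ^ k"
    using prod_add[OF fE(1), of "\<lambda>e. p * ?y e" "\<lambda>_. 1 - p"] by simp
  \<comment> \<open>Pairs outside \<open>?T\<close> contribute the factor
    \<open>p + (1 - p) = 1\<close>.\<close>
  also have "(\<Prod>e\<in>?E. p * ?y e + (1 - p)) = (1 + p * (x - 1)) ^ card ?T"
  proof -
    have "(\<Prod>e\<in>?E. p * ?y e + (1 - p)) = (\<Prod>e\<in>?E. if e \<in> ?T then 1 + p * (x - 1) else 1)"
      by (intro prod.cong) (auto simp: algebra_simps)
    then show ?thesis using fE TE by (simp add: prod.If_cases)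
  qed
  also have "\<dots> / x ^ k \<le> exp (p * (real a)\<^sup>2 / 2 * (x - 1)) / x ^ k"
  proof (rule divide_right_mono)
    have "(1 + p * (x - 1)) ^ card ?T \<le> exp (p * (x - 1)) ^ card ?T"
      using p x by (intro power_mono) auto
    also have "\<dots> = exp (real (card ?T) * (p * (x - 1)))" by (rule exp_of_nat_mult[symmetric])
    also have "\<dots> \<le> exp ((real a)\<^sup>2 / 2 * (p * (x - 1)))"
    proof -
      have "real (card ?T) \<le> (real a)\<^sup>2 / 2"
        using card_nsets_2[of "{..<a}"] by (simp add: power2_eq_square algebra_simps)
      then show ?thesis using p x
        by (simp only: exp_le_cancel_iff) (intro mult_right_mono, auto)
    qed
    finally show "(1 + p * (x - 1)) ^ card ?T \<le> exp (p * (real a)\<^sup>2 / 2 * (x - 1))"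
      by (simp add: mult_ac)
  qed (use x in simp)
  finally show ?thesis .
qed

section \<open>Asymptotics on both sides of the threshold\<close>

lemma exp_neg_mult_tendsto_0:
  fixes f :: "'a \<Rightarrow> real"
  assumes "0 < c" "filterlim f at_top F"
  shows "((\<lambda>n. exp (- (c * f n))) \<longlongrightarrow> 0) F"
proof -
  have "filterlim (\<lambda>n. c * f n) at_top F"
    using assms by (intro filterlim_tendsto_pos_mult_at_top[OF tendsto_const])
  then have "filterlim (\<lambda>n. - (c * f n)) at_bot F"
    by (simp add: filterlim_uminus_at_top)
  then show ?thesis by (rule filterlim_compose[OF exp_at_bot])
qed

theorem theorem1p5:
  fixes \<eta> d :: "nat \<Rightarrow> real"
  assumes eta_omega: "filterlim \<eta> at_top even_at_top"
    and eta_o: "\<eta> \<in> o[even_at_top](\<lambda>n. real n)"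
    and d_eq: "\<And>n. even n \<Longrightarrow> d n = real n / 2 - \<eta> n"
  shows "\<forall>\<epsilon>>0.
    (\<exists>H :: nat \<Rightarrow> nat set set.
        (\<forall>n. even n \<longrightarrow> simple_graph {..<n} (H n)) \<and>
        (\<forall>\<^sub>F n in even_at_top. real (min_degree {..<n} (H n)) \<ge> d n) \<and>
        (\<forall>p :: nat \<Rightarrow> real.
            (\<forall>n. even n \<longrightarrow> 0 \<le> p n \<and> p n \<le> 1) \<longrightarrow>
            (\<forall>\<^sub>F n in even_at_top. p n \<le> (1 - \<epsilon>) * (8 * \<eta> n / (real n)\<^sup>2)) \<longrightarrow>
            ((\<lambda>n. prob_perfect_matching n (H n) (p n)) \<longlongrightarrow> 0) even_at_top)) \<and>
    (\<forall>H :: nat \<Rightarrow> nat set set.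
        (\<forall>n. even n \<longrightarrow> simple_graph {..<n} (H n)) \<longrightarrow>
        (\<forall>\<^sub>F n in even_at_top. real (min_degree {..<n} (H n)) \<ge> d n) \<longrightarrow>
        (\<forall>p :: nat \<Rightarrow> real.
            (\<forall>n. even n \<longrightarrow> 0 \<le> p n \<and> p n \<le> 1) \<longrightarrow>
            (\<forall>\<^sub>F n in even_at_top. p n \<ge> (1 + \<epsilon>) * (8 * \<eta> n / (real n)\<^sup>2)) \<longrightarrow>
            ((\<lambda>n. prob_perfect_matching n (H n) (p n)) \<longlongrightarrow> 1) even_at_top))"
proof (intro allI impI conjI)
  fix \<epsilon> :: real assume \<epsilon>: "0 < \<epsilon>"
  \<comment> \<open>Here \<open>0 < n\<close> follows from the other bounds: at \<open>n = 0\<close>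
    the last one would contradict \<open>1 \<le> \<eta> n\<close>.\<close>
  have ev: "\<forall>\<^sub>F n in even_at_top. even n \<and> 0 < n \<and> 1 \<le> \<eta> n \<and> \<eta> n \<le> \<delta> * n" if "0 < \<delta>" for \<delta> :: real
  proof -
    have "\<forall>\<^sub>F n in even_at_top. even n"
      by (simp add: even_at_top_def eventually_inf_principal)
    moreover have "\<forall>\<^sub>F n in even_at_top. 1 \<le> \<eta> n"
      using eta_omega by (simp add: filterlim_at_top)
    moreover have "\<forall>\<^sub>F n in even_at_top. norm (\<eta> n) \<le> \<delta> * norm (real n)"
      by (rule landau_o.smallD[OF eta_o that])
    ultimately show ?thesis
      by eventually_elim (auto intro: gr0I)
  qed
  show "\<exists>H :: nat \<Rightarrow> nat set set.
        (\<forall>n. even n \<longrightarrow> simple_graph {..<n} (H n)) \<and>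
        (\<forall>\<^sub>F n in even_at_top. real (min_degree {..<n} (H n)) \<ge> d n) \<and>
        (\<forall>p :: nat \<Rightarrow> real.
            (\<forall>n. even n \<longrightarrow> 0 \<le> p n \<and> p n \<le> 1) \<longrightarrow>
            (\<forall>\<^sub>F n in even_at_top. p n \<le> (1 - \<epsilon>) * (8 * \<eta> n / (real n)\<^sup>2)) \<longrightarrow>
            ((\<lambda>n. prob_perfect_matching n (H n) (p n)) \<longlongrightarrow> 0) even_at_top)"
  proof -
    \<comment> \<open>Rounding down keeps \<open>n - a n\<close> at least \<open>d n\<close> and
      lowers the number of required edges by at most one.\<close>
    define k where "k n = nat \<lfloor>\<eta> n\<rfloor>" for n
    define a where "a n = n div 2 + k n" for n
    \<comment> \<open>This gives \<open>1 - \<epsilon> \<le> 1 - 2 * c\<close>, and the cap at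
      \<open>1/2\<close> keeps \<open>1 - 2 * c\<close> positive for large
      \<open>\<epsilon>\<close>. Half of the slack \<open>2 * c\<close> pays for \<open>a n\<close>
      exceeding \<open>n / 2\<close>; the other half drives the decay.\<close>
    define c where "c = min \<epsilon> (1/2) / 2"
    have c: "0 < c" "c \<le> 1/4" "2 * c \<le> \<epsilon>" using \<epsilon> by (auto simp: c_def)
    \<comment> \<open>With \<open>\<eta> n \<le> c / 8 * n\<close>, the square of \<open>a n\<close>
      is at most \<open>n^2 / 4 * (1 + c / 4)^2\<close>, an excess factor of at most
      \<open>1 + c\<close>.\<close>
    have \<delta>: "0 < c / 8" using c by simp
    have a: "a n \<le> n" "0 < a n" "real (a n) \<le> real n / 2 + \<eta> n" "\<eta> n - 1 \<le> real (k n)"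
      if "even n \<and> 0 < n \<and> 1 \<le> \<eta> n \<and> \<eta> n \<le> c / 8 * n" for n
    proof -
      have k: "real (k n) \<le> \<eta> n" "\<eta> n - 1 \<le> real (k n)" using that by (auto simp: k_def)
      have half: "real (n div 2) = real n / 2" using that by (simp add: real_of_nat_div)
      show le: "real (a n) \<le> real n / 2 + \<eta> n" using k half by (simp add: a_def)
      have "c / 8 * n \<le> 1 / 2 * n" using c by (intro mult_right_mono) auto
      then have "real (a n) \<le> real n" using le that by linarith
      then show "a n \<le> n" by simp
      show "0 < a n" using that by (auto simp: a_def)
      show "\<eta> n - 1 \<le> real (k n)" by fact
    qed
    let ?H = "\<lambda>n. touching_edges n (a n)"
    show ?thesis
    proof (intro exI[of _ ?H] conjI allI impI)
      show "simple_graph {..<n} (?H n)" for n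
        by (auto simp: simple_graph_def touching_edges_def)
      show "\<forall>\<^sub>F n in even_at_top. real (min_degree {..<n} (?H n)) \<ge> d n"
        using ev[OF \<delta>]
      proof eventually_elim
        case (elim n)
        have "real (n - a n) \<le> real (min_degree {..<n} (?H n))"
          using min_degree_touching_edges a[OF elim] by (intro of_nat_mono) blast
        then show ?case using a[OF elim] d_eq elim by (simp add: of_nat_diff)
      qed
      fix p :: "nat \<Rightarrow> real"
      assume p01: "\<forall>n. even n \<longrightarrow> 0 \<le> p n \<and> p n \<le> 1"
        and pup: "\<forall>\<^sub>F n in even_at_top. p n \<le> (1 - \<epsilon>) * (8 * \<eta> n / (real n)\<^sup>2)"
      \<comment> \<open>Each required edge gains \<open>ln x\<close>, at least
        \<open>c / 2 - c^2 / 4\<close>, against a cost of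
        \<open>(1 - c) * (c / 2) = c / 2 - c^2 / 2\<close>; the difference \<open>\<kappa>\<close>
        is therefore positive.\<close>
      define x where "x = 1 + c / 2"
      have x: "1 \<le> x" "x - 1 = c / 2" using c by (auto simp: x_def)
      define \<kappa> where "\<kappa> = ln x - (1 - c) * (c / 2)"
      have "c / 2 - (c / 2)\<^sup>2 \<le> ln x"
        unfolding x_def using c by (intro ln_one_plus_pos_lower_bound) auto
      moreover have "0 < c\<^sup>2" using c by simp
      ultimately have \<kappa>: "0 < \<kappa>" by (simp add: \<kappa>_def power2_eq_square field_simps)
      have bound: "\<forall>\<^sub>F n in even_at_top. prob_perfect_matching n (?H n) (p n) \<le> x * exp (- (\<kappa> * \<eta> n))"
        using ev[OF \<delta>] pup
      proof eventually_elim
        case (elim n)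
        note an = a[OF elim(1)]
        have p: "0 \<le> p n" "p n \<le> 1" using p01 elim by auto
        have "p n \<le> (1 - 2 * c) * (8 * \<eta> n / (real n)\<^sup>2)"
          using elim(1) c(3) by (intro order_trans[OF elim(2)] mult_right_mono) auto
        moreover have "real (a n) \<le> (1/2 + c / 8) * n" using an(3) elim(1) by (simp add: algebra_simps)
        ultimately have "p n * (real (a n))\<^sup>2 \<le> ((1 - 2 * c) * (8 * \<eta> n / (real n)\<^sup>2)) * ((1/2 + c / 8) * n)\<^sup>2"
          using p elim(1) by (intro mult_mono power_mono) auto
        also have "\<dots> = 2 * ((1 - 2 * c) * (1 + c / 4)\<^sup>2) * \<eta> n"
          using elim(1) by (simp add: power2_eq_square field_simps)
        also have "\<dots> \<le> 2 * (1 - c) * \<eta> n"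
        proof -
          have "(1 - 2 * c) * (1 + c / 4)\<^sup>2 \<le> (1 - 2 * c) * (1 + c)"
          proof (rule mult_left_mono)
            have "c * c \<le> c * 1" using c by (intro mult_left_mono) auto
            moreover have "(1 + c / 4)\<^sup>2 = 1 + c / 2 + c * c / 16" by (simp add: power2_eq_square field_simps)
            ultimately show "(1 + c / 4)\<^sup>2 \<le> 1 + c" using c by linarith
          qed (use c in auto)
          also have "\<dots> = 1 - c - 2 * (c * c)" by (simp add: algebra_simps)
          also have "\<dots> \<le> 1 - c" by simp
          finally show ?thesis using elim(1) by (intro mult_right_mono) auto
        qed
        finally have e: "p n * (real (a n))\<^sup>2 / 2 * (x - 1) \<le> (1 - c) * \<eta> n * (c / 2)"
          unfolding x(2) using c by (intro mult_right_mono) (auto simp: algebra_simps)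
        have "prob_perfect_matching n (?H n) (p n) \<le> exp (p n * (real (a n))\<^sup>2 / 2 * (x - 1)) / x ^ k n"
          using prob_touching_edges_le[OF a_def an(1) p x(1)] .
        \<comment> \<open>Replacing \<open>k n\<close> by \<open>\<eta> n - 1\<close> accounts for
          the rounding and produces the constant factor \<open>x\<close> of the bound.\<close>
        also have "\<dots> \<le> exp ((1 - c) * \<eta> n * (c / 2)) / exp ((\<eta> n - 1) * ln x)"
        proof (rule frac_le)
          have "(\<eta> n - 1) * ln x \<le> real (k n) * ln x" using an(4) x by (intro mult_right_mono) auto
          then have "exp ((\<eta> n - 1) * ln x) \<le> exp (real (k n) * ln x)" by simp
          also have "\<dots> = x ^ k n" using x by (simp add: exp_of_nat_mult)
          finally show "exp ((\<eta> n - 1) * ln x) \<le> x ^ k n" .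
        qed (use e in auto)
        also have "\<dots> = exp (ln x + - (\<kappa> * \<eta> n))"
          unfolding exp_diff[symmetric] by (simp add: \<kappa>_def field_simps)
        also have "\<dots> = x * exp (- (\<kappa> * \<eta> n))" using x by (simp only: exp_add) simp
        finally show ?case .
      qed
      show "((\<lambda>n. prob_perfect_matching n (?H n) (p n)) \<longlongrightarrow> 0) even_at_top"
      proof (rule tendsto_sandwich[OF _ bound tendsto_const])
        show "\<forall>\<^sub>F n in even_at_top. 0 \<le> prob_perfect_matching n (?H n) (p n)"
          by (simp add: prob_perfect_matching_def)
        show "((\<lambda>n. x * exp (- (\<kappa> * \<eta> n))) \<longlongrightarrow> 0) even_at_top"
          by (intro tendsto_mult_right_zero exp_neg_mult_tendsto_0 \<kappa> eta_omega)
      qed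
    qed
  qed
  fix H :: "nat \<Rightarrow> nat set set" and p :: "nat \<Rightarrow> real"
  assume H: "\<forall>n. even n \<longrightarrow> simple_graph {..<n} (H n)"
    and deg: "\<forall>\<^sub>F n in even_at_top. real (min_degree {..<n} (H n)) \<ge> d n"
    and p01: "\<forall>n. even n \<longrightarrow> 0 \<le> p n \<and> p n \<le> 1"
    and plow: "\<forall>\<^sub>F n in even_at_top. p n \<ge> (1 + \<epsilon>) * (8 * \<eta> n / (real n)\<^sup>2)"
  define c where "c = \<epsilon> / 2"
  \<comment> \<open>Chosen so that \<open>(1 + 2 * c) * (1 - 4 * \<delta>) = 1 + c\<close>: the loss
    from \<open>k\<close> being only at least \<open>(1 / 2 - \<delta>) * n\<close> uses half of the
    surplus \<open>\<epsilon> = 2 * c\<close>.\<close>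
  define \<delta> where "\<delta> = c / (4 * (1 + 2 * c))"
  have c: "0 < c" "\<epsilon> = 2 * c" using \<epsilon> by (auto simp: c_def)
  have \<delta>: "0 < \<delta>" "\<delta> \<le> 1 / 8" "4 * \<delta> * (1 + 2 * c) = c" using c by (auto simp: \<delta>_def field_simps)
  \<comment> \<open>With \<open>x = 1 + c\<close> the random edges contribute the exponent
    \<open>- (c * \<eta> n)\<close>, since \<open>(1 + c) * (1 - 1 / (1 + c)) = c\<close>. The
    initial deficit, at most \<open>\<eta> n\<close>, contributes at most
    \<open>\<eta> n * ln (1 + c)\<close>.\<close>
  define \<kappa> where "\<kappa> = c - ln (1 + c)"
  have \<kappa>: "0 < \<kappa>" using ln_add_one_self_less_self[OF c(1)] by (simp add: \<kappa>_def)
  have bound: "\<forall>\<^sub>F n in even_at_top. 1 - exp (- (\<kappa> * \<eta> n)) \<le> prob_perfect_matching n (H n) (p n)"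
    using ev[OF \<delta>(1)] deg plow
  proof eventually_elim
    case (elim n)
    define k where "k = min_degree {..<n} (H n)"
    have p: "0 \<le> p n" "p n \<le> 1" using p01 elim by auto
    have k: "real n / 2 - \<eta> n \<le> real k" using elim d_eq by (simp add: k_def)
    have "\<delta> * n \<le> 1 / 8 * n" using \<delta> by (intro mult_right_mono) auto
    then have k': "0 \<le> (1 / 2 - \<delta>) * n" "(1 / 2 - \<delta>) * n \<le> real k"
      using k elim(1) by (auto simp: algebra_simps)
    have "(1 + c) * \<eta> n \<le> (1 + 2 * c) * (1 - 2 * \<delta>)\<^sup>2 * \<eta> n"
    proof (rule mult_right_mono)
      have "(1 + 2 * c) * (1 - 4 * \<delta>) \<le> (1 + 2 * c) * (1 - 2 * \<delta>)\<^sup>2"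
        using c by (intro mult_left_mono) (auto simp: power2_eq_square algebra_simps)
      then show "1 + c \<le> (1 + 2 * c) * (1 - 2 * \<delta>)\<^sup>2" using \<delta>(3) by (simp add: algebra_simps)
    qed (use elim in auto)
    also have "\<dots> = (1 + \<epsilon>) * (8 * \<eta> n / (real n)\<^sup>2) * (((1 / 2 - \<delta>) * n)\<^sup>2 / 2)"
      using elim(1) c(2) by (simp add: power2_eq_square field_simps)
    also have "\<dots> \<le> p n * ((real k)\<^sup>2 / 2)"
      using elim p k' by (intro mult_mono divide_right_mono power_mono) auto
    finally have pk: "(1 + c) * \<eta> n \<le> p n * ((real k)\<^sup>2 / 2)" .
    have "1 - prob_perfect_matching n (H n) (p n)
      \<le> exp (- (p n * ((real k)\<^sup>2 / 2 * (1 - 1 / (1 + c))))) * (1 + c) ^ (n div 2 - k)"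
    proof (rule prob_no_perfect_matching_le)
      show "H n \<subseteq> nsets {..<n} 2" using H elim by (auto simp: simple_graph_def)
      show "k \<le> degree (H n) v" if "v < n" for v
        unfolding k_def min_degree_def using that by (intro Min_le) auto
    qed (use elim p c in auto)
    also have "\<dots> \<le> exp (- (c * \<eta> n)) * exp (\<eta> n * ln (1 + c))"
    proof (rule mult_mono)
      have "(1 + c) * \<eta> n * (1 - 1 / (1 + c)) \<le> p n * ((real k)\<^sup>2 / 2) * (1 - 1 / (1 + c))"
        using c by (intro mult_right_mono[OF pk]) auto
      moreover have "(1 + c) * \<eta> n * (1 - 1 / (1 + c)) = c * \<eta> n" using c by (simp add: field_simps)
      ultimately show "exp (- (p n * ((real k)\<^sup>2 / 2 * (1 - 1 / (1 + c))))) \<le> exp (- (c * \<eta> n))"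
        by (simp only: exp_le_cancel_iff neg_le_iff_le mult.assoc)
      have "real (n div 2 - k) \<le> \<eta> n"
      \<comment> \<open>For \<open>k > n div 2\<close> the truncated difference is 0, below
        \<open>\<eta> n\<close>.\<close>
      proof (cases "k \<le> n div 2")
        case True
        then show ?thesis using k elim by (simp add: of_nat_diff real_of_nat_div)
      qed (use elim in auto)
      then have "real (n div 2 - k) * ln (1 + c) \<le> \<eta> n * ln (1 + c)"
        using c by (intro mult_right_mono) auto
      moreover have "(1 + c) ^ (n div 2 - k) = exp (real (n div 2 - k) * ln (1 + c))"
        using c by (simp only: exp_of_nat_mult) simp
      ultimately show "(1 + c) ^ (n div 2 - k) \<le> exp (\<eta> n * ln (1 + c))" by simp
    qed (use c in auto)
    also have "\<dots> = exp (- (\<kappa> * \<eta> n))"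
      unfolding exp_add[symmetric] by (simp add: \<kappa>_def algebra_simps)
    finally show ?case by simp
  qed
  show "((\<lambda>n. prob_perfect_matching n (H n) (p n)) \<longlongrightarrow> 1) even_at_top"
  proof (rule tendsto_sandwich[OF bound])
    show "\<forall>\<^sub>F n in even_at_top. prob_perfect_matching n (H n) (p n) \<le> 1"
      by (simp add: prob_perfect_matching_def)
    show "((\<lambda>n. 1 - exp (- (\<kappa> * \<eta> n))) \<longlongrightarrow> 1) even_at_top"
      using tendsto_diff[OF tendsto_const exp_neg_mult_tendsto_0[OF \<kappa> eta_omega], of 1] by simp
  qed simp
qed

end
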